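(* There exists a polynomial-time algorithm that, given a ballot profile $\vec{A}=(A_1,\dots,A_n)$ over a candidate set $C$ and a committee $W\subseteq C$ with $|W|=k$, decides whether $W$ provides justified representation for $(\vec{A},k)$.
   Context: Setting. $N=\{1,\dots,n\}$ ($n\ge 1$) is a set of voters, $C$ is a finite set of candidates. Each voter $i\in N$ submits an approval ballot $A_i\subseteq C$; the list $\vec{A}=(A_1,\dots,A_n)$ is the ballot profile. The committee size $k$ satisfies $1\le k\le|C|$. Justified representation (JR). A set $W\subseteq C$ with $|W|=k$ provides justified representation for $(\vec{A},k)$ if there is no set of voters $N^*\subseteq N$ with $|N^*|\ge \frac{n}{k}$ such that $\bigcap_{i\in N^*}A_i\neq\emptyset$ and $A_i\cap W=\emptyset$ for all $i\in N^*$. Polynomial time means polynomial in the size of the input $(\vec{A},C,W)$, i.e. in $n$ and $|C|$. *)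

theory Defs
  imports "HOL-Computational_Algebra.Polynomial"
begin

section \<open>Justified representation\<close>

text \<open>
  Voters are \<open>1, \<dots>, n\<close>; a ballot profile is a function of which only the values
  on \<open>{1..n}\<close> matter. As \<open>n \<ge> 1\<close> and \<open>k \<ge> 1\<close>, the cardinality bound forces the group
  \<open>G\<close> to be nonempty, so the intersection is never taken over the empty index set.
\<close>

definition justified_representation ::
  "nat \<Rightarrow> (nat \<Rightarrow> 'c set) \<Rightarrow> nat \<Rightarrow> 'c set \<Rightarrow> bool" where
  "justified_representation n A k W \<longleftrightarrow>
     \<not> (\<exists>G. G \<subseteq> {1..n} \<and> real (card G) \<ge> real n / real k \<and>
            (\<Inter>i\<in>G. A i) \<noteq> {} \<and> (\<forall>i\<in>G. A i \<inter> W = {}))"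

definition jr_instance ::
  "nat \<Rightarrow> 'c set \<Rightarrow> (nat \<Rightarrow> 'c set) \<Rightarrow> nat \<Rightarrow> 'c set \<Rightarrow> bool" where
  "jr_instance n C A k W \<longleftrightarrow>
     n \<ge> 1 \<and> finite C \<and> (\<forall>i\<in>{1..n}. A i \<subseteq> C) \<and>
     1 \<le> k \<and> k \<le> card C \<and> W \<subseteq> C \<and> card W = k"

section \<open>Deterministic multi-tape Turing machines\<close>

text \<open>
  States and symbols are initial segments of the natural numbers. The transition function
  maps a state and the list of scanned symbols to a new state and, for each tape, a symbol
  to write and a head movement. Restricted to the arguments occurring in
  \<open>turing_machine\<close>, it is a finite table; values elsewhere are irrelevant, because no
  configuration reachable from an input over the machine's alphabet uses them.
\<close>

datatype move = Left | Stay | Right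

record tm =
  num_tapes :: nat
  num_symbols :: nat
  num_states :: nat
  start_state :: nat
  accept_state :: nat
  reject_state :: nat
  transition :: "nat \<Rightarrow> nat list \<Rightarrow> nat \<times> (nat \<times> move) list"

abbreviation (input) blank :: nat where "blank \<equiv> 0"
abbreviation (input) left_marker :: nat where "left_marker \<equiv> 1"
abbreviation (input) sym_zero :: nat where "sym_zero \<equiv> 2"
abbreviation (input) sym_one :: nat where "sym_one \<equiv> 3"
abbreviation (input) sym_sep :: nat where "sym_sep \<equiv> 4"

definition turing_machine :: "tm \<Rightarrow> bool" where
  "turing_machine M \<longleftrightarrow>
     num_tapes M \<ge> 1 \<and> num_symbols M \<ge> 5 \<and>
     start_state M < num_states M \<and> accept_state M < num_states M \<and>
     reject_state M < num_states M \<and> accept_state M \<noteq> reject_state M \<and>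
     (\<forall>q rs. q < num_states M \<and> length rs = num_tapes M \<and> (\<forall>r\<in>set rs. r < num_symbols M) \<longrightarrow>
        fst (transition M q rs) < num_states M \<and>
        length (snd (transition M q rs)) = num_tapes M \<and>
        (\<forall>(s, d)\<in>set (snd (transition M q rs)). s < num_symbols M))"

text \<open>
  A tape is infinite to the right and consists of its contents and the head position.
  Moving left from cell 0 leaves the head at cell 0.
\<close>

type_synonym tape = "(nat \<Rightarrow> nat) \<times> nat"

definition read_tape :: "tape \<Rightarrow> nat" where
  "read_tape t = fst t (snd t)"

fun move_head :: "move \<Rightarrow> nat \<Rightarrow> nat" where
  "move_head Left h = h - 1"
| "move_head Stay h = h"
| "move_head Right h = h + 1"

definition act_tape :: "nat \<times> move \<Rightarrow> tape \<Rightarrow> tape" where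
  "act_tape a t = ((fst t)(snd t := fst a), move_head (snd a) (snd t))"

type_synonym config = "nat \<times> tape list"

text \<open>Accepting and rejecting configurations are fixed points of the step function.\<close>

definition tm_step :: "tm \<Rightarrow> config \<Rightarrow> config" where
  "tm_step M c =
     (if fst c = accept_state M \<or> fst c = reject_state M then c
      else let (q', as) = transition M (fst c) (map read_tape (snd c))
           in (q', map2 act_tape as (snd c)))"

text \<open>
  Initially all heads are at cell 0, which holds the left marker; the input word occupies
  cells 1, 2, \<dots> of the first tape and all other cells are blank.
\<close>

definition init_tape :: "nat list \<Rightarrow> tape" where
  "init_tape xs =
     (\<lambda>i. if i = 0 then left_marker
          else if i \<le> length xs then xs ! (i - 1) else blank, 0)"

definition init_config :: "tm \<Rightarrow> nat list \<Rightarrow> config" where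
  "init_config M xs =
     (start_state M, init_tape xs # replicate (num_tapes M - 1) (init_tape []))"

text \<open>
  As halting configurations are fixed points, the state after \<open>t\<close> iterations is accepting
  (rejecting) iff the machine accepts (rejects) within at most \<open>t\<close> steps.
\<close>

definition accepts_within :: "tm \<Rightarrow> nat list \<Rightarrow> nat \<Rightarrow> bool" where
  "accepts_within M xs t \<longleftrightarrow> fst ((tm_step M ^^ t) (init_config M xs)) = accept_state M"

definition rejects_within :: "tm \<Rightarrow> nat list \<Rightarrow> nat \<Rightarrow> bool" where
  "rejects_within M xs t \<longleftrightarrow> fst ((tm_step M ^^ t) (init_config M xs)) = reject_state M"

section \<open>Encoding of instances\<close>

text \<open>
  Given a listing \<open>cs\<close> of the candidates, a set of candidates is written as its 0/1
  characteristic vector followed by a separator. The input word consists of the vector of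
  the committee, then those of the ballots of voters \<open>1, \<dots>, n\<close>; its length is
  \<open>(n + 1) * (length cs + 1)\<close>. The committee size is not written separately: it is the
  cardinality of the committee.
\<close>

definition encode_set :: "'c list \<Rightarrow> 'c set \<Rightarrow> nat list" where
  "encode_set cs B = map (\<lambda>c. if c \<in> B then sym_one else sym_zero) cs @ [sym_sep]"

definition encode_instance :: "nat \<Rightarrow> 'c list \<Rightarrow> (nat \<Rightarrow> 'c set) \<Rightarrow> 'c set \<Rightarrow> nat list" where
  "encode_instance n cs A W =
     encode_set cs W @ concat (map (\<lambda>i. encode_set cs (A i)) [1..<n + 1])"

end

theory Submission
  imports Defs
begin

text \<open>
  A committee fails justified representation iff for some candidate \<open>c\<close> the number of voters
  approving \<open>c\<close> but no committee member, times \<open>k\<close>, is at least \<open>n\<close>. A machine with four tapes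
  checks this candidate by candidate. Tape 2 holds a copy of the vector of \<open>W\<close>; tape 3 holds
  \<open>p\<close> in unary, \<open>p\<close> being the index of the current candidate; on tape 4 exactly the cells
  \<open>0, \<dots>, n - 1\<close> are nonblank. While a ballot is scanned, the heads of tapes 2 and 3 move along
  and two flags in the state record whether the ballot meets \<open>W\<close> and whether it contains the
  current candidate. When the heads of tapes 2 and 3 return to the left end, a counted ballot
  makes the head of tape 4 advance once for every member of \<open>W\<close>, that is \<open>k\<close> times. At the end
  of the input the head of tape 4 scans a blank iff the current candidate is a violation.
  The vector of \<open>W\<close> at the front of the input may be treated as one more ballot, since it
  meets \<open>W\<close>. As heads do not fall off the left end, all tapes are rewound simultaneously
  by following tape 1.
\<close>

section \<open>Bounded reachability\<close>

text \<open>The bound is only an upper one, so that times of consecutive phases add up and may be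
  rounded up.\<close>

definition reaches :: "tm \<Rightarrow> nat \<Rightarrow> config \<Rightarrow> config \<Rightarrow> bool" where
  "reaches M t c c' \<longleftrightarrow> (\<exists>s\<le>t. (tm_step M ^^ s) c = c')"

lemma reaches_refl: "reaches M t c c"
  unfolding reaches_def by (rule exI[of _ 0]) simp

lemma reaches_step: "tm_step M c = c' \<Longrightarrow> reaches M 1 c c'"
  unfolding reaches_def by (rule exI[of _ 1]) simp

lemma reaches_trans:
  assumes "reaches M s c c'" "reaches M t c' c''"
  shows "reaches M (s + t) c c''"
proof -
  obtain i j where "i \<le> s" "(tm_step M ^^ i) c = c'" "j \<le> t" "(tm_step M ^^ j) c' = c''"
    using assms unfolding reaches_def by blast
  then have "j + i \<le> s + t" "(tm_step M ^^ (j + i)) c = c''"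
    by (auto simp: funpow_add)
  then show ?thesis unfolding reaches_def by blast
qed

lemma reaches_mono: "reaches M s c c' \<Longrightarrow> s \<le> t \<Longrightarrow> reaches M t c c'"
  unfolding reaches_def using le_trans by blast

text \<open>A halting configuration is a fixed point, so reaching it within \<open>t\<close> steps
  means being in it after exactly \<open>t\<close> steps.\<close>

lemma reaches_halted:
  assumes "reaches M t c c'" "fst c' = accept_state M \<or> fst c' = reject_state M"
  shows "(tm_step M ^^ t) c = c'"
proof -
  obtain s where s: "s \<le> t" "(tm_step M ^^ s) c = c'"
    using assms(1) unfolding reaches_def by blast
  have "(tm_step M ^^ i) c' = c'" for i
    by (induction i) (use assms(2) in \<open>auto simp: tm_step_def\<close>)
  moreover have "(tm_step M ^^ t) c = (tm_step M ^^ (t - s)) ((tm_step M ^^ s) c)"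
    using s(1) by (simp flip: funpow_add comp_apply[of "tm_step M ^^ _"])
  ultimately show ?thesis using s(2) by simp
qed

section \<open>The machine\<close>

text \<open>
  \<open>Copy\<close> writes the vector of \<open>W\<close> to tape 2, \<open>Count\<close> writes \<open>n\<close> to tape 4 and \<open>Rewind\<close> moves all
  heads to cell 0. \<open>Advance\<close> increments \<open>p\<close>. In \<open>Scan x y\<close>, the flag \<open>x\<close> records that the ballot
  meets \<open>W\<close> and \<open>y\<close> is the bit at the last cell seen that is nonblank on tape 3. \<open>Retreat g\<close> moves
  heads 2 and 3 back and, if \<open>g\<close>, advances head 4 by \<open>k\<close>.
\<close>

datatype state =
  Copy | Count | Rewind | Advance | Retreat bool | Scan bool bool | Accept | Reject

fun code :: "state \<Rightarrow> nat" where
  "code Copy = 0"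
| "code Count = 1"
| "code Rewind = 2"
| "code Advance = 3"
| "code (Retreat g) = 4 + of_bool g"
| "code (Scan x y) = 6 + of_bool x + 2 * of_bool y"
| "code Accept = 10"
| "code Reject = 11"

lemma code_eq_iff [simp]: "code s = code s' \<longleftrightarrow> s = s'"
  by (cases s; cases s') (auto simp: of_bool_def split: if_splits)

lemma code_less: "code s < 12"
  by (cases s) (auto simp: of_bool_def)

lemma inv_code [simp]: "inv code (code s) = s"
  by (simp add: inj_def)

text \<open>Scanned symbols are written back except where \<open>Copy\<close> fills tape 2,
  \<open>Count\<close> tape 4 and \<open>Advance\<close> tape 3. At a separator \<open>Scan\<close>
  leaves head 1 in place; the end of \<open>Retreat\<close> moves it on.\<close>

fun delta :: "state \<Rightarrow> nat \<Rightarrow> nat \<Rightarrow> nat \<Rightarrow> nat \<Rightarrow> state \<times> (nat \<times> move) list" where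
  "delta Copy a b c d =
     (if a = sym_sep then (Count, [(a, Right), (b, Stay), (c, Stay), (d, Stay)])
      else (Copy, [(a, Right), (a, Right), (c, Stay), (d, Stay)]))"
| "delta Count a b c d =
     (if a = blank then (Rewind, [(a, Stay), (b, Stay), (c, Stay), (d, Stay)])
      else if a = sym_sep then (Count, [(a, Right), (b, Stay), (c, Stay), (sym_one, Right)])
      else (Count, [(a, Right), (b, Stay), (c, Stay), (d, Stay)]))"
| "delta Rewind a b c d =
     (if a = left_marker then (Advance, [(a, Stay), (b, Stay), (c, Stay), (d, Stay)])
      else (Rewind, [(a, Left), (b, Left), (c, Left), (d, Left)]))"
| "delta Advance a b c d =
     (if c \<noteq> blank then (Advance, [(a, Stay), (b, Right), (c, Right), (d, Stay)])
      else if b = blank then (Accept, [(a, Stay), (b, Stay), (c, Stay), (d, Stay)])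
      else (Retreat False, [(a, Stay), (b, Stay), (sym_one, Stay), (d, Stay)]))"
| "delta (Retreat g) a b c d =
     (if b = left_marker then (Scan False False, [(a, Right), (b, Right), (c, Right), (d, Stay)])
      else (Retreat g, [(a, Stay), (b, Left), (c, Left),
                        (d, if g \<and> b = sym_one then Right else Stay)]))"
| "delta (Scan x y) a b c d =
     (if a = blank then (if d = blank then Reject else Rewind,
                         [(a, Stay), (b, Stay), (c, Stay), (d, Stay)])
      else if a = sym_sep then (Retreat (\<not> x \<and> y), [(a, Stay), (b, Stay), (c, Stay), (d, Stay)])
      else (Scan (x \<or> a = sym_one \<and> b = sym_one) (if c \<noteq> blank then a = sym_one else y),
            [(a, Right), (b, Right), (c, Right), (d, Stay)]))"
| "delta Accept a b c d = (Accept, [(a, Stay), (b, Stay), (c, Stay), (d, Stay)])"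
| "delta Reject a b c d = (Reject, [(a, Stay), (b, Stay), (c, Stay), (d, Stay)])"

definition jr_tm :: tm where
  "jr_tm = \<lparr>num_tapes = 4, num_symbols = 5, num_states = 12,
     start_state = code Copy, accept_state = code Accept, reject_state = code Reject,
     transition = \<lambda>q rs. apfst code (delta (inv code q) (rs ! 0) (rs ! 1) (rs ! 2) (rs ! 3))\<rparr>"

lemma delta_wf:
  assumes "a < 5" "b < 5" "c < 5" "d < 5"
  shows "length (snd (delta s a b c d)) = 4 \<and> (\<forall>(r, _)\<in>set (snd (delta s a b c d)). r < 5)"
  using assms by (cases s) auto

lemma turing_machine_jr_tm: "turing_machine jr_tm"
proof -
  have "length (snd (delta s (rs ! 0) (rs ! 1) (rs ! 2) (rs ! 3))) = 4 \<and>
      (\<forall>(r, _)\<in>set (snd (delta s (rs ! 0) (rs ! 1) (rs ! 2) (rs ! 3))). r < 5)"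
    if "length rs = 4" "\<forall>r\<in>set rs. r < 5" for s and rs :: "nat list"
    using that by (intro delta_wf) (auto simp: all_set_conv_all_nth)
  then show ?thesis
    unfolding turing_machine_def jr_tm_def by (fastforce simp: code_less simp del: code.simps)
qed

definition conf ::
  "state \<Rightarrow> (nat \<Rightarrow> nat) \<Rightarrow> nat \<Rightarrow> (nat \<Rightarrow> nat) \<Rightarrow> nat \<Rightarrow> (nat \<Rightarrow> nat) \<Rightarrow> nat \<Rightarrow> (nat \<Rightarrow> nat) \<Rightarrow> nat \<Rightarrow> config"
where
  "conf s f1 h1 f2 h2 f3 h3 f4 h4 = (code s, [(f1, h1), (f2, h2), (f3, h3), (f4, h4)])"

text \<open>Rules that write back the scanned symbol give updates of the form
  \<open>f(h := f h)\<close>, removed below by \<open>fun_upd_idem\<close>.\<close>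

lemma step_conf:
  assumes "s \<noteq> Accept" "s \<noteq> Reject"
    and "delta s (f1 h1) (f2 h2) (f3 h3) (f4 h4) = (s', [(r1, d1), (r2, d2), (r3, d3), (r4, d4)])"
  shows "tm_step jr_tm (conf s f1 h1 f2 h2 f3 h3 f4 h4) =
    conf s' (f1(h1 := r1)) (move_head d1 h1) (f2(h2 := r2)) (move_head d2 h2)
      (f3(h3 := r3)) (move_head d3 h3) (f4(h4 := r4)) (move_head d4 h4)"
  using assms
  by (simp add: tm_step_def conf_def jr_tm_def read_tape_def act_tape_def del: code.simps)

text \<open>Each move subtracts 1 from every head position, truncated at 0; no head starts to the
  right of head 1, so all are at cell 0 when head 1 meets the marker.\<close>

lemma rewind:
  assumes "f1 0 = left_marker" "\<And>i. 0 < i \<Longrightarrow> i \<le> h1 \<Longrightarrow> f1 i \<noteq> left_marker"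
    and "h2 \<le> h1" "h3 \<le> h1" "h4 \<le> h1"
  shows "reaches jr_tm (h1 + 1) (conf Rewind f1 h1 f2 h2 f3 h3 f4 h4)
    (conf Advance f1 0 f2 0 f3 0 f4 0)"
  using assms
proof (induction h1 arbitrary: h2 h3 h4)
  case 0
  then have "tm_step jr_tm (conf Rewind f1 0 f2 0 f3 0 f4 0) = conf Advance f1 0 f2 0 f3 0 f4 0"
    by (simp add: step_conf fun_upd_idem)
  from reaches_step[OF this] show ?case using 0 by simp
next
  case (Suc h1)
  have "tm_step jr_tm (conf Rewind f1 (Suc h1) f2 h2 f3 h3 f4 h4) =
      conf Rewind f1 h1 f2 (h2 - 1) f3 (h3 - 1) f4 (h4 - 1)"
    using Suc.prems(2)[of "Suc h1"] by (simp add: step_conf fun_upd_idem)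
  moreover have "reaches jr_tm (h1 + 1) (conf Rewind f1 h1 f2 (h2 - 1) f3 (h3 - 1) f4 (h4 - 1))
      (conf Advance f1 0 f2 0 f3 0 f4 0)"
    using Suc.prems by (intro Suc.IH) auto
  ultimately show ?case
    using reaches_trans[OF reaches_step] by fastforce
qed

section \<open>Correctness of the machine\<close>

text \<open>
  Block \<open>0\<close> of the input is the vector of the committee, block \<open>i\<close> that of ballot \<open>i\<close>. Candidates
  are numbered from 1, so that candidate \<open>j\<close> belongs to cell \<open>j\<close> of tapes 2 and 3.
\<close>

locale jr_input =
  fixes n m :: nat and B :: "nat \<Rightarrow> nat \<Rightarrow> bool" and inp :: "nat \<Rightarrow> nat"
  assumes n_pos: "0 < n"
    and inp_0: "inp 0 = left_marker"
    and inp_bit: "i \<le> n \<Longrightarrow> 1 \<le> j \<Longrightarrow> j \<le> m \<Longrightarrow>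
      inp (i * (m + 1) + j) = (if B i j then sym_one else sym_zero)"
    and inp_sep: "i \<le> n \<Longrightarrow> inp (i * (m + 1) + (m + 1)) = sym_sep"
    and inp_end: "inp ((n + 1) * (m + 1) + 1) = blank"
begin

definition committee_tape :: "nat \<Rightarrow> nat \<Rightarrow> nat" where
  "committee_tape h j =
     (if j = 0 then left_marker else if j < h then (if B 0 j then sym_one else sym_zero) else blank)"

definition index_tape :: "nat \<Rightarrow> nat \<Rightarrow> nat" where
  "index_tape p j = (if j = 0 then left_marker else if j \<le> p then sym_one else blank)"

text \<open>The first voter overwrites the marker in cell 0. Hence for \<open>q > 0\<close> a head
  at cell \<open>j\<close> scans a blank iff \<open>q \<le> j\<close>.\<close>

definition voters_tape :: "nat \<Rightarrow> nat \<Rightarrow> nat" where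
  "voters_tape q j = (if j < q then sym_one else if j = 0 then left_marker else blank)"

abbreviation cfg :: "state \<Rightarrow> nat \<Rightarrow> nat \<Rightarrow> nat \<Rightarrow> nat \<Rightarrow> nat \<Rightarrow> config" where
  "cfg s p h1 h2 h3 h4 \<equiv>
     conf s inp h1 (committee_tape (m + 1)) h2 (index_tape p) h3 (voters_tape n) h4"

definition K :: nat where
  "K = card {j\<in>{1..m}. B 0 j}"

lemma init_config_eq:
  assumes "inp = fst (init_tape xs)"
  shows "init_config jr_tm xs =
    conf Copy inp 0 (committee_tape 0) 0 (index_tape 0) 0 (voters_tape 0) 0"
proof -
  have "init_tape [] = (committee_tape 0, 0)" "init_tape [] = (index_tape 0, 0)"
    "init_tape [] = (voters_tape 0, 0)"
    by (auto simp: init_tape_def fun_eq_iff committee_tape_def index_tape_def voters_tape_def)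
  moreover have "init_tape xs = (inp, 0)"
    using assms by (simp add: init_tape_def)
  ultimately show ?thesis
    by (simp add: init_config_def jr_tm_def conf_def numeral_3_eq_3)
qed

definition meets :: "nat \<Rightarrow> nat \<Rightarrow> bool" where
  "meets i j \<longleftrightarrow> (\<exists>j'\<in>{1..j}. B i j' \<and> B 0 j')"

lemma meets_Suc: "meets i (Suc j) \<longleftrightarrow> meets i j \<or> B i (Suc j) \<and> B 0 (Suc j)"
  by (auto simp: meets_def atLeastAtMostSuc_conv)

text \<open>The count covers the blocks before block \<open>i\<close>, including block 0, which is
  the committee and not a ballot.\<close>

definition supporters :: "nat \<Rightarrow> nat \<Rightarrow> nat" where
  "supporters p i = card {i'. i' < i \<and> \<not> meets i' m \<and> B i' p}"

text \<open>Keeps a rewind from stopping before cell 0.\<close>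

lemma inp_not_left_marker:
  assumes "0 < h" "h \<le> (n + 1) * (m + 1) + 1"
  shows "inp h \<noteq> left_marker"
proof (cases "h = (n + 1) * (m + 1) + 1")
  case True
  then show ?thesis using inp_end by simp
next
  case False
  \<comment> \<open>The input starts at cell 1, hence the shift: \<open>j\<close> runs from 1 to
    \<open>m + 1\<close>, the value \<open>m + 1\<close> being the separator.\<close>
  define i j where "i = (h - 1) div (m + 1)" and "j = (h - 1) mod (m + 1) + 1"
  have "h - 1 < (n + 1) * (m + 1)" using assms False by simp
  then have "i < n + 1" unfolding i_def by (rule less_mult_imp_div_less)
  then have i: "i \<le> n" by simp
  have "j \<le> m + 1" "1 \<le> j" unfolding j_def by (simp_all add: less_Suc_eq_le[symmetric])
  moreover have "h = i * (m + 1) + j"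
    unfolding i_def j_def using assms(1) div_mult_mod_eq[of "h - 1" "m + 1"] by linarith
  ultimately show ?thesis
    using inp_bit[OF i, of j] inp_sep[OF i] by (cases "j = m + 1") auto
qed

section \<open>Initialisation: copying the committee and counting the voters\<close>

lemma copy:
  assumes "h \<le> m + 1"
  shows "reaches jr_tm h
    (conf Copy inp 0 (committee_tape 0) 0 (index_tape 0) 0 (voters_tape 0) 0)
    (conf Copy inp h (committee_tape h) h (index_tape 0) 0 (voters_tape 0) 0)"
  using assms
proof (induction h)
  case 0
  show ?case by (rule reaches_refl)
next
  case (Suc h)
  have "inp h \<noteq> sym_sep \<and> (committee_tape h)(h := inp h) = committee_tape (Suc h)"
    using inp_bit[of 0 h] inp_0 Suc.prems
    by (cases "h = 0") (auto simp: committee_tape_def fun_eq_iff)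
  then have "tm_step jr_tm (conf Copy inp h (committee_tape h) h (index_tape 0) 0 (voters_tape 0) 0)
    = conf Copy inp (Suc h) (committee_tape (Suc h)) (Suc h) (index_tape 0) 0 (voters_tape 0) 0"
    by (simp add: step_conf fun_upd_idem)
  then show ?case
    using reaches_trans[OF Suc.IH reaches_step] Suc.prems by simp
qed

lemma count_block:
  assumes "i \<le> n" "j \<le> m"
  shows "reaches jr_tm j
    (conf Count inp (i * (m + 1) + 1) f2 h2 f3 h3 f4 h4)
    (conf Count inp (i * (m + 1) + 1 + j) f2 h2 f3 h3 f4 h4)"
  using assms(2)
proof (induction j)
  case 0
  show ?case by (simp add: reaches_refl)
next
  case (Suc j)
  have "tm_step jr_tm (conf Count inp (i * (m + 1) + 1 + j) f2 h2 f3 h3 f4 h4)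
    = conf Count inp (i * (m + 1) + 1 + Suc j) f2 h2 f3 h3 f4 h4"
    using inp_bit[OF assms(1), of "Suc j"] Suc.prems
    by (cases "B i (Suc j)") (simp_all add: step_conf fun_upd_idem)
  then show ?case
    using reaches_trans[OF Suc.IH reaches_step] Suc.prems by simp
qed

text \<open>Head 1 starts just behind the separator of block 0, so only the ballots are counted; a
  block takes \<open>m\<close> bit steps and one separator step.\<close>

lemma count:
  assumes "i \<le> n"
  shows "reaches jr_tm (i * (m + 1))
    (conf Count inp (m + 1 + 1) f2 h2 f3 h3 (voters_tape 0) 0)
    (conf Count inp ((i + 1) * (m + 1) + 1) f2 h2 f3 h3 (voters_tape i) i)"
  using assms
proof (induction i)
  case 0
  show ?case by (simp add: reaches_refl)
next
  case (Suc i)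
  have "(voters_tape i)(i := sym_one) = voters_tape (Suc i)"
    by (auto simp: voters_tape_def fun_eq_iff)
  then have "tm_step jr_tm
      (conf Count inp ((i + 1) * (m + 1) + 1 + m) f2 h2 f3 h3 (voters_tape i) i)
    = conf Count inp ((Suc i + 1) * (m + 1) + 1) f2 h2 f3 h3 (voters_tape (Suc i)) (Suc i)"
    using inp_sep[of "i + 1"] Suc.prems by (simp add: step_conf fun_upd_idem algebra_simps)
  then have "reaches jr_tm (i * (m + 1) + m + 1)
    (conf Count inp (m + 1 + 1) f2 h2 f3 h3 (voters_tape 0) 0)
    (conf Count inp ((Suc i + 1) * (m + 1) + 1) f2 h2 f3 h3 (voters_tape (Suc i)) (Suc i))"
    using Suc.prems
    by (intro reaches_trans[OF reaches_trans[OF Suc.IH count_block] reaches_step]) auto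
  then show ?case
    by (rule reaches_mono) simp
qed

text \<open>The forward pass and the rewind each spend one step on every cell from 0 to
  \<open>(n + 1) * (m + 1) + 1\<close>.\<close>

definition init_time :: nat where
  "init_time = 2 * ((n + 1) * (m + 1)) + 4"

lemma initialise:
  "reaches jr_tm init_time
    (conf Copy inp 0 (committee_tape 0) 0 (index_tape 0) 0 (voters_tape 0) 0)
    (cfg Advance 0 0 0 0 0)"
proof -
  let ?f = "committee_tape (m + 1)"
  have 1: "tm_step jr_tm
      (conf Copy inp (m + 1) ?f (m + 1) (index_tape 0) 0 (voters_tape 0) 0)
    = conf Count inp (m + 1 + 1) ?f (m + 1) (index_tape 0) 0 (voters_tape 0) 0"
    using inp_sep[of 0] by (simp add: step_conf fun_upd_idem)
  have 2: "tm_step jr_tm (cfg Count 0 ((n + 1) * (m + 1) + 1) (m + 1) 0 n)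
    = cfg Rewind 0 ((n + 1) * (m + 1) + 1) (m + 1) 0 n"
    using inp_end by (simp add: step_conf fun_upd_idem)
  have 3: "reaches jr_tm ((n + 1) * (m + 1) + 1 + 1)
    (cfg Rewind 0 ((n + 1) * (m + 1) + 1) (m + 1) 0 n) (cfg Advance 0 0 0 0 0)"
    using inp_0 inp_not_left_marker by (intro rewind) auto
  show ?thesis
    by (rule reaches_mono[OF reaches_trans[OF copy[OF order_refl] reaches_trans[OF reaches_step[OF 1]
      reaches_trans[OF count[OF order_refl] reaches_trans[OF reaches_step[OF 2] 3]]]]])
      (simp add: init_time_def)
qed

section \<open>Moving to the next candidate\<close>

lemma advance_scan:
  "h \<le> p + 1 \<Longrightarrow> reaches jr_tm h (cfg Advance p 0 0 0 0) (cfg Advance p 0 h h 0)"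
proof (induction h)
  case 0
  show ?case by (rule reaches_refl)
next
  case (Suc h)
  have "tm_step jr_tm (cfg Advance p 0 h h 0) = cfg Advance p 0 (Suc h) (Suc h) 0"
    using Suc.prems by (cases h) (simp_all add: step_conf fun_upd_idem index_tape_def)
  then show ?case
    using reaches_trans[OF Suc.IH reaches_step] Suc.prems by simp
qed

text \<open>The start \<open>h\<close> may be \<open>m + 1\<close>, where tape 2 is blank; hence the
  restriction \<open>j \<le> m\<close>. The last step moves head 1 off the separator, or off cell 0
  at the start of a round.\<close>

lemma retreat:
  assumes "h \<le> m + 1"
  shows "reaches jr_tm (h + 1) (cfg (Retreat g) p h1 h h h4)
    (cfg (Scan False False) p (h1 + 1) 1 1
      (h4 + (if g then card {j\<in>{1..h}. j \<le> m \<and> B 0 j} else 0)))"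
  using assms
proof (induction h arbitrary: h4)
  case 0
  have "tm_step jr_tm (cfg (Retreat g) p h1 0 0 h4) = cfg (Scan False False) p (h1 + 1) 1 1 h4"
    by (simp add: step_conf fun_upd_idem committee_tape_def)
  from reaches_step[OF this] show ?case by (cases g) simp_all
next
  case (Suc h)
  let ?S = "\<lambda>h. {j\<in>{1..h}. j \<le> m \<and> B 0 j}"
  let ?d = "of_bool (g \<and> Suc h \<le> m \<and> B 0 (Suc h)) :: nat"
  have "tm_step jr_tm (cfg (Retreat g) p h1 (Suc h) (Suc h) h4) = cfg (Retreat g) p h1 h h (h4 + ?d)"
    by (cases g; cases "Suc h \<le> m"; cases "B 0 (Suc h)")
      (simp_all add: step_conf fun_upd_idem committee_tape_def)
  then have *: "reaches jr_tm (1 + (h + 1)) (cfg (Retreat g) p h1 (Suc h) (Suc h) h4)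
     (cfg (Scan False False) p (h1 + 1) 1 1 (h4 + ?d + (if g then card (?S h) else 0)))"
    using Suc.prems by (intro reaches_trans[OF reaches_step Suc.IH]) auto
  have "?S (Suc h) = (if Suc h \<le> m \<and> B 0 (Suc h) then insert (Suc h) (?S h) else ?S h)"
    by (auto simp: le_Suc_eq)
  then have "h4 + ?d + (if g then card (?S h) else 0) = h4 + (if g then card (?S (Suc h)) else 0)"
    by simp
  with * show ?case by simp
qed

lemma advance:
  assumes "p < m"
  shows "reaches jr_tm (2 * m + 3) (cfg Advance p 0 0 0 0) (cfg (Scan False False) (p + 1) 1 1 1 0)"
proof -
  have "(index_tape p)(p + 1 := sym_one) = index_tape (p + 1)"
    by (auto simp: index_tape_def fun_eq_iff)
  \<comment> \<open>Tape 2 is nonblank at cell \<open>p + 1\<close> because \<open>p < m\<close>: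
    there is another candidate.\<close>
  then have 1: "tm_step jr_tm (cfg Advance p 0 (p + 1) (p + 1) 0)
    = cfg (Retreat False) (p + 1) 0 (p + 1) (p + 1) 0"
    using assms
    by (cases "B 0 (p + 1)") (simp_all add: step_conf fun_upd_idem index_tape_def committee_tape_def)
  have 2: "reaches jr_tm (p + 1 + 1) (cfg (Retreat False) (p + 1) 0 (p + 1) (p + 1) 0)
    (cfg (Scan False False) (p + 1) 1 1 1 0)"
    using retreat[of "p + 1" False 0 "p + 1" 0] assms by simp
  show ?thesis
    by (rule reaches_mono[OF reaches_trans[OF advance_scan[OF order_refl]
      reaches_trans[OF reaches_step[OF 1] 2]]]) (use assms in simp)
qed

lemma advance_accept:
  "reaches jr_tm (m + 2) (cfg Advance m 0 0 0 0) (cfg Accept m 0 (m + 1) (m + 1) 0)"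
proof -
  have "tm_step jr_tm (cfg Advance m 0 (m + 1) (m + 1) 0) = cfg Accept m 0 (m + 1) (m + 1) 0"
    by (simp add: step_conf fun_upd_idem index_tape_def committee_tape_def)
  from reaches_trans[OF advance_scan[OF order_refl] reaches_step[OF this]] show ?thesis by simp
qed

section \<open>Scanning the ballots\<close>

lemma scan_bits:
  assumes "i \<le> n" "1 \<le> p" "j \<le> m"
  shows "reaches jr_tm j (cfg (Scan False False) p (i * (m + 1) + 1) 1 1 h4)
    (cfg (Scan (meets i j) (1 \<le> j \<and> B i (min j p))) p (i * (m + 1) + 1 + j) (1 + j) (1 + j) h4)"
  using assms(3)
proof (induction j)
  case 0
  show ?case by (simp add: reaches_refl meets_def)
next
  case (Suc j)
  \<comment> \<open>Tape 3 is nonblank up to cell \<open>p\<close> only, so the second flag follows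
    the bits up to \<open>p\<close> and then keeps that of candidate \<open>p\<close>.\<close>
  have "tm_step jr_tm
      (cfg (Scan (meets i j) (1 \<le> j \<and> B i (min j p))) p (i * (m + 1) + 1 + j) (1 + j) (1 + j) h4)
    = cfg (Scan (meets i (Suc j)) (1 \<le> Suc j \<and> B i (min (Suc j) p))) p
        (i * (m + 1) + 1 + Suc j) (1 + Suc j) (1 + Suc j) h4"
    using inp_bit[OF assms(1), of "Suc j"] Suc.prems assms(2)
    by (cases "B i (Suc j)"; cases "B 0 (Suc j)"; cases j p rule: linorder_cases)
      (auto simp: step_conf fun_upd_idem meets_Suc committee_tape_def index_tape_def min_def)
  then show ?case
    using reaches_trans[OF Suc.IH reaches_step] Suc.prems by simp
qed

lemma scan_block:
  assumes "i \<le> n" "1 \<le> p" "p \<le> m"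
  shows "reaches jr_tm (2 * m + 3) (cfg (Scan False False) p (i * (m + 1) + 1) 1 1 h4)
    (cfg (Scan False False) p ((i + 1) * (m + 1) + 1) 1 1
      (h4 + (if \<not> meets i m \<and> B i p then K else 0)))"
proof -
  have 1: "tm_step jr_tm
      (cfg (Scan (meets i m) (1 \<le> m \<and> B i (min m p))) p (i * (m + 1) + 1 + m) (1 + m) (1 + m) h4)
    = cfg (Retreat (\<not> meets i m \<and> B i p)) p ((i + 1) * (m + 1)) (m + 1) (m + 1) h4"
    using inp_sep[OF assms(1)] assms(2,3) by (simp add: step_conf fun_upd_idem min_def algebra_simps)
  \<comment> \<open>Started at cell \<open>m + 1\<close>, the retreat passes the whole vector of the
    committee, so a counted ballot advances head 4 by \<open>K\<close>.\<close>
  have "{j\<in>{1..m + 1}. j \<le> m \<and> B 0 j} = {j\<in>{1..m}. B 0 j}"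
    by auto
  then have 2: "reaches jr_tm (m + 1 + 1)
      (cfg (Retreat (\<not> meets i m \<and> B i p)) p ((i + 1) * (m + 1)) (m + 1) (m + 1) h4)
      (cfg (Scan False False) p ((i + 1) * (m + 1) + 1) 1 1
        (h4 + (if \<not> meets i m \<and> B i p then K else 0)))"
    using retreat[of "m + 1" "\<not> meets i m \<and> B i p" "(i + 1) * (m + 1)" p h4]
    unfolding K_def by (cases "\<not> meets i m \<and> B i p") (auto simp: algebra_simps)
  show ?thesis
    by (rule reaches_mono[OF reaches_trans[OF scan_bits[OF assms(1,2) order_refl]
      reaches_trans[OF reaches_step[OF 1] 2]]]) simp
qed

lemma supporters_Suc:
  "supporters p (Suc i) = supporters p i + (if \<not> meets i m \<and> B i p then 1 else 0)"
proof -
  have "{i'. i' < Suc i \<and> \<not> meets i' m \<and> B i' p} =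
    (if \<not> meets i m \<and> B i p then insert i else id) {i'. i' < i \<and> \<not> meets i' m \<and> B i' p}"
    by (auto simp: less_Suc_eq)
  then show ?thesis by (simp add: supporters_def)
qed

lemma scan:
  assumes "1 \<le> p" "p \<le> m" "i \<le> n + 1"
  shows "reaches jr_tm (i * (2 * m + 3)) (cfg (Scan False False) p 1 1 1 0)
    (cfg (Scan False False) p (i * (m + 1) + 1) 1 1 (K * supporters p i))"
  using assms(3)
proof (induction i)
  case 0
  show ?case by (simp add: reaches_refl supporters_def)
next
  case (Suc i)
  have eq: "K * supporters p (Suc i) =
      K * supporters p i + (if \<not> meets i m \<and> B i p then K else 0)"
    by (simp add: supporters_Suc)
  have "reaches jr_tm (i * (2 * m + 3) + (2 * m + 3)) (cfg (Scan False False) p 1 1 1 0)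
    (cfg (Scan False False) p ((i + 1) * (m + 1) + 1) 1 1 (K * supporters p (Suc i)))"
    unfolding eq using Suc.prems assms
    by (intro reaches_trans[OF Suc.IH scan_block]) auto
  then show ?case by (simp add: add.commute)
qed

section \<open>Rounds and verdict\<close>

definition violation :: "nat \<Rightarrow> bool" where
  "violation p \<longleftrightarrow> n \<le> K * supporters p (n + 1)"

text \<open>The summands stand for choosing the candidate, scanning \<open>n + 1\<close> blocks, the
  verdict and the rewind. A rejecting round saves the last.\<close>

definition round_time :: nat where
  "round_time = 2 * m + 3 + (n + 1) * (2 * m + 3) + 1 + ((n + 1) * (m + 1) + 2)"

lemma round_reject:
  assumes "p < m" "violation (p + 1)"
  shows "\<exists>c. fst c = code Reject \<and> reaches jr_tm round_time (cfg Advance p 0 0 0 0) c"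
proof -
  let ?h = "(n + 1) * (m + 1) + 1" and ?h4 = "K * supporters (p + 1) (n + 1)"
  \<comment> \<open>Head 4 is at cell \<open>n\<close> or beyond, past all marks;
    \<open>n > 0\<close> excludes cell 0.\<close>
  have "voters_tape n ?h4 = blank"
    unfolding voters_tape_def using assms(2) n_pos by (simp add: violation_def del: mult_is_0 mult_eq_0_iff)
  then have 1: "tm_step jr_tm (cfg (Scan False False) (p + 1) ?h 1 1 ?h4) = cfg Reject (p + 1) ?h 1 1 ?h4"
    using inp_end by (simp add: step_conf fun_upd_idem)
  have "reaches jr_tm round_time (cfg Advance p 0 0 0 0) (cfg Reject (p + 1) ?h 1 1 ?h4)"
    by (rule reaches_mono[OF reaches_trans[OF advance[OF assms(1)]
      reaches_trans[OF scan[of "p + 1" "n + 1"] reaches_step[OF 1]]]])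
      (use assms(1) in \<open>auto simp: round_time_def\<close>)
  then show ?thesis by (auto simp: conf_def)
qed

lemma round_continue:
  assumes "p < m" "\<not> violation (p + 1)"
  shows "reaches jr_tm round_time (cfg Advance p 0 0 0 0) (cfg Advance (p + 1) 0 0 0 0)"
proof -
  let ?h = "(n + 1) * (m + 1) + 1" and ?h4 = "K * supporters (p + 1) (n + 1)"
  have h4: "?h4 < n" using assms(2) by (simp add: violation_def)
  have 1: "tm_step jr_tm (cfg (Scan False False) (p + 1) ?h 1 1 ?h4) = cfg Rewind (p + 1) ?h 1 1 ?h4"
    using inp_end h4 by (simp add: step_conf fun_upd_idem voters_tape_def)
  \<comment> \<open>The bound \<open>?h4 < n\<close> also keeps head 4 to the left of head 1, as
    \<open>rewind\<close> demands.\<close>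
  have 2: "reaches jr_tm (?h + 1) (cfg Rewind (p + 1) ?h 1 1 ?h4) (cfg Advance (p + 1) 0 0 0 0)"
    using inp_0 inp_not_left_marker h4 by (intro rewind) (auto intro: less_imp_le trans_less_add1)
  show ?thesis
    by (rule reaches_mono[OF reaches_trans[OF advance[OF assms(1)]
      reaches_trans[OF scan[of "p + 1" "n + 1"] reaches_trans[OF reaches_step[OF 1] 2]]]])
      (use assms(1) in \<open>auto simp: round_time_def\<close>)
qed

lemma rounds:
  assumes "p \<le> m" "\<And>p'. 1 \<le> p' \<Longrightarrow> p' \<le> p \<Longrightarrow> \<not> violation p'"
  shows "reaches jr_tm (p * round_time) (cfg Advance 0 0 0 0 0) (cfg Advance p 0 0 0 0)"
  using assms
proof (induction p)
  case 0
  show ?case by (simp add: reaches_refl)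
next
  case (Suc p)
  have "reaches jr_tm (p * round_time + round_time)
      (cfg Advance 0 0 0 0 0) (cfg Advance (p + 1) 0 0 0 0)"
    using Suc.prems by (intro reaches_trans[OF Suc.IH round_continue]) auto
  then show ?case by (simp add: add.commute)
qed

text \<open>At most \<open>m\<close> rounds occur; the extra \<open>round_time\<close> pays for the
  \<open>m + 2\<close> steps to acceptance.\<close>

definition run_time :: nat where
  "run_time = init_time + (m + 1) * round_time"

lemma decide:
  "\<exists>c. fst c = code (if \<not> (\<exists>p\<in>{1..m}. violation p) then Accept else Reject) \<and>
     reaches jr_tm run_time
       (conf Copy inp 0 (committee_tape 0) 0 (index_tape 0) 0 (voters_tape 0) 0) c"
proof (cases "\<exists>p\<in>{1..m}. violation p")
  case True
  \<comment> \<open>The machine rejects at the first violation; all earlier rounds continue.\<close>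
  define q where "q = (LEAST p. 1 \<le> p \<and> violation p)"
  obtain p0 where p0: "1 \<le> p0" "p0 \<le> m" "violation p0" using True by auto
  have q: "1 \<le> q" "violation q"
    using LeastI[of "\<lambda>p. 1 \<le> p \<and> violation p" p0] p0 by (auto simp: q_def)
  have "q \<le> m"
    using Least_le[of "\<lambda>p. 1 \<le> p \<and> violation p" p0] p0 by (simp add: q_def)
  moreover have "\<not> violation p'" if "1 \<le> p'" "p' \<le> q - 1" for p'
    using not_less_Least[of p' "\<lambda>p. 1 \<le> p \<and> violation p"] that q(1) by (auto simp: q_def)
  moreover have "q - 1 < m" "q - 1 + 1 = q"
    using q(1) \<open>q \<le> m\<close> by auto
  then obtain c where c: "fst c = code Reject"
    "reaches jr_tm round_time (cfg Advance (q - 1) 0 0 0 0) c"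
    using round_reject[of "q - 1"] q(2) by metis
  ultimately have "reaches jr_tm (init_time + ((q - 1) * round_time + round_time))
      (conf Copy inp 0 (committee_tape 0) 0 (index_tape 0) 0 (voters_tape 0) 0) c"
    by (intro reaches_trans[OF initialise reaches_trans[OF rounds c(2)]]) auto
  moreover have "(q - 1) * round_time + round_time = q * round_time"
    using q(1) by (cases q) auto
  then have "init_time + ((q - 1) * round_time + round_time) \<le> run_time"
    using \<open>q \<le> m\<close> unfolding run_time_def by (simp del: mult_Suc)
  ultimately have "reaches jr_tm run_time
      (conf Copy inp 0 (committee_tape 0) 0 (index_tape 0) 0 (voters_tape 0) 0) c"
    using reaches_mono by blast
  then show ?thesis
    using True c(1) by (intro exI[of _ c]) simp
next
  case False
  then have "reaches jr_tm (init_time + (m * round_time + (m + 2)))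
      (conf Copy inp 0 (committee_tape 0) 0 (index_tape 0) 0 (voters_tape 0) 0)
      (cfg Accept m 0 (m + 1) (m + 1) 0)"
    by (intro reaches_trans[OF initialise reaches_trans[OF rounds advance_accept]]) auto
  then have "reaches jr_tm run_time
      (conf Copy inp 0 (committee_tape 0) 0 (index_tape 0) 0 (voters_tape 0) 0)
      (cfg Accept m 0 (m + 1) (m + 1) 0)"
    by (rule reaches_mono) (simp add: run_time_def round_time_def)
  with False show ?thesis by (auto simp: conf_def)
qed

end

section \<open>Cubic time bound\<close>

definition time_poly :: "nat poly" where
  "time_poly = [:16:] * [:1, 1:] ^ 3"

lemma (in jr_input) run_time_le: "run_time \<le> poly time_poly (n + m)"
proof -
  define a b y where "a = n + 1" and "b = m + 1" and "y = n + m + 1"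
  have le: "a \<le> y" "b \<le> y" "1 \<le> y" unfolding a_def b_def y_def by auto
  have y2: "y * y \<le> y * y * y" "y \<le> y * y * y" "1 \<le> y * y * y"
    using le(3) by (simp_all add: Suc_le_eq)
  have "a * b \<le> y * y" "b * b \<le> y * y" "a * b * b \<le> y * y * y"
    using le by (intro mult_le_mono; simp)+
  then have ab: "a * b \<le> y * y * y" "b * b \<le> y * y * y" "b \<le> y * y * y" "a * b * b \<le> y * y * y"
    using y2 le(2) by linarith+
  \<comment> \<open>The coefficients sum to 16 and every monomial is at most
    \<open>y * y * y\<close>; this is the constant in \<open>time_poly\<close>.\<close>
  have "run_time = 3 * (a * b * b) + 3 * (a * b) + 2 * (b * b) + 4 * b + 4"
    unfolding run_time_def init_time_def round_time_def a_def b_def by (simp add: algebra_simps)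
  also have "\<dots> \<le> 16 * (y * y * y)"
    using ab y2(3) by linarith
  also have "\<dots> = poly time_poly (n + m)"
    by (simp add: time_poly_def y_def power3_eq_cube algebra_simps)
  finally show ?thesis .
qed

section \<open>Justified representation\<close>

lemma nth_concat_map_uniform:
  assumes "\<And>x. x \<in> set xs \<Longrightarrow> length (f x) = l" "i < length xs" "j < l"
  shows "concat (map f xs) ! (i * l + j) = f (xs ! i) ! j"
  using assms(1,2)
proof (induction xs arbitrary: i)
  case Nil
  then show ?case by simp
next
  case (Cons x xs)
  then show ?case using assms(3) by (cases i) (auto simp: nth_append)
qed

text \<open>With the committee as block 0 all blocks form one uniform list, so that a single index
  formula covers them.\<close>

lemma encode_instance_eq:
  "encode_instance n cs A W = concat (map (\<lambda>i. encode_set cs (if i = 0 then W else A i)) [0..<n + 1])"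
proof -
  have upt: "[0..<n + 1] = 0 # [1..<n + 1]" by (simp add: upt_rec)
  have ballots: "map (\<lambda>i. encode_set cs (if i = 0 then W else A i)) [1..<n + 1] =
      map (\<lambda>i. encode_set cs (A i)) [1..<n + 1]"
    by (rule map_cong) auto
  show ?thesis
    unfolding encode_instance_def upt list.map ballots by (simp del: upt_Suc)
qed

lemma length_encode_instance: "length (encode_instance n cs A W) = (n + 1) * (length cs + 1)"
  by (simp add: encode_instance_eq length_concat comp_def encode_set_def sum_list_triv)

lemma jr_input_encode_instance:
  assumes "0 < n"
  shows "jr_input n (length cs) (\<lambda>i j. cs ! (j - 1) \<in> (if i = 0 then W else A i))
    (fst (init_tape (encode_instance n cs A W)))"
proof -
  let ?B = "\<lambda>i. if i = 0 then W else A i" and ?m = "length cs"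
  let ?inp = "fst (init_tape (encode_instance n cs A W))"
  \<comment> \<open>Cell numbers exceed list positions by 1 because of the marker;
    \<open>j = ?m + 1\<close> covers the separator.\<close>
  have cell: "?inp (i * (?m + 1) + j) = encode_set cs (?B i) ! (j - 1)"
    if "i \<le> n" "1 \<le> j" "j \<le> ?m + 1" for i j
  proof -
    have "i * (?m + 1) + j \<le> n * (?m + 1) + (?m + 1)"
      using that by (intro add_mono mult_le_mono1) auto
    then have "?inp (i * (?m + 1) + j) = encode_instance n cs A W ! (i * (?m + 1) + (j - 1))"
      using that by (simp add: init_tape_def length_encode_instance)
    also have "\<dots> = encode_set cs (?B ([0..<n + 1] ! i)) ! (j - 1)"
      unfolding encode_instance_eq using that
      by (intro nth_concat_map_uniform) (auto simp: encode_set_def)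
    finally show ?thesis using that by (simp add: nth_append del: upt_Suc)
  qed
  show ?thesis
  proof
    show "?inp (i * (?m + 1) + j) = (if cs ! (j - 1) \<in> ?B i then sym_one else sym_zero)"
      if "i \<le> n" "1 \<le> j" "j \<le> ?m" for i j
      using cell[of i j] that by (simp add: encode_set_def nth_append)
    show "?inp (i * (?m + 1) + (?m + 1)) = sym_sep" if "i \<le> n" for i
      using cell[of i "?m + 1"] that by (simp add: encode_set_def nth_append)
  qed (use assms in \<open>simp_all add: init_tape_def length_encode_instance\<close>)
qed

text \<open>A group that violates the condition shares some \<open>c\<close> and lies in the set of
  all unrepresented voters approving \<open>c\<close>. That set is then itself such a group, so it
  suffices to test one group per candidate.\<close>

lemma justified_representation_iff:
  assumes "jr_instance n C A k W"
  shows "justified_representation n A k W \<longleftrightarrow>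
    \<not> (\<exists>c\<in>C. n \<le> k * card {i\<in>{1..n}. A i \<inter> W = {} \<and> c \<in> A i})"
proof -
  let ?S = "\<lambda>c. {i\<in>{1..n}. A i \<inter> W = {} \<and> c \<in> A i}"
  have pos: "0 < n" "0 < k" and AC: "\<And>i. i \<in> {1..n} \<Longrightarrow> A i \<subseteq> C"
    using assms by (auto simp: jr_instance_def)
  have size: "real l \<ge> real n / real k \<longleftrightarrow> n \<le> k * l" for l
  proof -
    have "real l \<ge> real n / real k \<longleftrightarrow> real n \<le> real (k * l)"
      using pos by (simp add: divide_le_eq mult.commute)
    then show ?thesis by (simp only: of_nat_le_iff)
  qed
  have "(\<exists>G. G \<subseteq> {1..n} \<and> n \<le> k * card G \<and> (\<Inter>i\<in>G. A i) \<noteq> {} \<and> (\<forall>i\<in>G. A i \<inter> W = {})) \<longleftrightarrow>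
    (\<exists>c\<in>C. n \<le> k * card (?S c))" (is "?L \<longleftrightarrow> ?R")
  proof
    assume ?L
    then obtain G c where G: "G \<subseteq> {1..n}" "n \<le> k * card G" "\<forall>i\<in>G. A i \<inter> W = {}"
      and c: "\<forall>i\<in>G. c \<in> A i" by auto
    \<comment> \<open>As the group is nonempty, \<open>c\<close> lies in some ballot and hence in
      \<open>C\<close>.\<close>
    have "G \<noteq> {}" using G(2) pos by auto
    with G(1) c AC have "c \<in> C" by blast
    moreover have "G \<subseteq> ?S c" using G c by auto
    then have "card G \<le> card (?S c)" by (intro card_mono) auto
    then have "n \<le> k * card (?S c)" using G(2) by (meson le_trans mult_le_mono2)
    ultimately show ?R by blast
  next
    assume ?R
    then obtain c where "n \<le> k * card (?S c)" by blast
    then show ?L by (intro exI[of _ "?S c"]) auto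
  qed
  then show ?thesis unfolding justified_representation_def size by simp
qed

lemma bex_nth_shift:
  "(\<exists>j\<in>{1..length xs}. P (xs ! (j - 1))) \<longleftrightarrow> (\<exists>x\<in>set xs. P x)"
proof -
  have "(\<exists>j\<in>{1..length xs}. P (xs ! (j - 1))) \<longleftrightarrow> (\<exists>i<length xs. P (xs ! i))"
    by (metis One_nat_def Suc_le_eq Suc_pred atLeastAtMost_iff diff_Suc_1 le_simps(3) zero_less_Suc)
  also have "\<dots> \<longleftrightarrow> (\<exists>x\<in>set xs. P x)"
    by (metis in_set_conv_nth)
  finally show ?thesis .
qed

lemma card_nth_shift:
  assumes "distinct xs"
  shows "card {j\<in>{1..length xs}. xs ! (j - 1) \<in> W} = card (set xs \<inter> W)"
proof -
  have "bij_betw (\<lambda>j. xs ! (j - 1)) {j\<in>{1..length xs}. xs ! (j - 1) \<in> W} (set xs \<inter> W)"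
  proof (rule bij_betw_imageI)
    show "inj_on (\<lambda>j. xs ! (j - 1)) {j\<in>{1..length xs}. xs ! (j - 1) \<in> W}"
      using assms by (auto simp: inj_on_def nth_eq_iff_index_eq)
    show "(\<lambda>j. xs ! (j - 1)) ` {j\<in>{1..length xs}. xs ! (j - 1) \<in> W} = set xs \<inter> W"
    proof
      show "set xs \<inter> W \<subseteq> (\<lambda>j. xs ! (j - 1)) ` {j\<in>{1..length xs}. xs ! (j - 1) \<in> W}"
      proof
        fix x assume "x \<in> set xs \<inter> W"
        then obtain i where "i < length xs" "x = xs ! i" "xs ! i \<in> W"
          by (auto simp: in_set_conv_nth)
        then show "x \<in> (\<lambda>j. xs ! (j - 1)) ` {j\<in>{1..length xs}. xs ! (j - 1) \<in> W}"
          by (intro image_eqI[of _ _ "i + 1"]) auto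
      qed
    qed auto
  qed
  then show ?thesis by (rule bij_betw_same_card)
qed

lemma jr_tm_decides:
  assumes inst: "jr_instance n C A k W" and cs: "distinct cs" "set cs = C"
  shows "fst ((tm_step jr_tm ^^ poly time_poly (n + card C))
      (init_config jr_tm (encode_instance n cs A W))) =
    code (if justified_representation n A k W then Accept else Reject)"
proof -
  let ?B = "\<lambda>i j. cs ! (j - 1) \<in> (if i = 0 then W else A i)"
  let ?inp = "fst (init_tape (encode_instance n cs A W))"
  have n: "0 < n" and W: "W \<subseteq> C" "card W = k" "0 < k" and AC: "\<And>i. i \<in> {1..n} \<Longrightarrow> A i \<subseteq> C"
    using inst by (auto simp: jr_instance_def)
  have m: "length cs = card C" using cs distinct_card by metis
  interpret jr_input n "length cs" ?B ?inp using n by (rule jr_input_encode_instance)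
  have K: "K = k"
    unfolding K_def using card_nth_shift[OF cs(1), of W] cs(2) W by (simp add: Int_absorb1)
  have meets: "meets i (length cs) \<longleftrightarrow> (if i = 0 then W else A i) \<inter> W \<noteq> {}" if "i \<le> n" for i
    unfolding meets_def
    using bex_nth_shift[of cs "\<lambda>c. c \<in> (if i = 0 then W else A i) \<and> c \<in> W"] cs(2) W(1) by auto
  \<comment> \<open>A nonempty committee meets itself, so block 0 drops out of the count of
    supporters.\<close>
  have "W \<noteq> {}" using W by auto
  then have supp: "{i. i < n + 1 \<and> \<not> meets i (length cs) \<and> ?B i p} =
      {i\<in>{1..n}. A i \<inter> W = {} \<and> cs ! (p - 1) \<in> A i}" for p
    using meets by (auto split: if_splits simp: less_Suc_eq_le Suc_le_eq)
  have "(\<exists>p\<in>{1..length cs}. violation p) \<longleftrightarrow>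
      (\<exists>c\<in>C. n \<le> k * card {i\<in>{1..n}. A i \<inter> W = {} \<and> c \<in> A i})"
    unfolding violation_def supporters_def supp K
    using bex_nth_shift[of cs "\<lambda>c. n \<le> k * card {i\<in>{1..n}. A i \<inter> W = {} \<and> c \<in> A i}"] cs(2)
    by simp
  then have jr: "justified_representation n A k W \<longleftrightarrow> \<not> (\<exists>p\<in>{1..length cs}. violation p)"
    using justified_representation_iff[OF inst] by simp
  obtain c where c: "fst c = code (if justified_representation n A k W then Accept else Reject)"
    "reaches jr_tm run_time (init_config jr_tm (encode_instance n cs A W)) c"
    using decide unfolding init_config_eq[OF refl] jr by blast
  have "(tm_step jr_tm ^^ poly time_poly (n + card C))
      (init_config jr_tm (encode_instance n cs A W)) = c"
    using reaches_mono[OF c(2) run_time_le] c(1) unfolding m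
    by (intro reaches_halted) (auto simp: jr_tm_def)
  with c(1) show ?thesis by simp
qed

theorem theorem2:
  "\<exists>(M :: tm) (p :: nat poly).
     turing_machine M \<and>
     (\<forall>n (C :: 'c set) A k W cs.
        jr_instance n C A k W \<and> distinct cs \<and> set cs = C \<longrightarrow>
        (if justified_representation n A k W
         then accepts_within M (encode_instance n cs A W) (poly p (n + card C))
         else rejects_within M (encode_instance n cs A W) (poly p (n + card C))))"
proof (intro exI[of _ jr_tm] exI[of _ time_poly] conjI allI impI)
  show "turing_machine jr_tm" by (rule turing_machine_jr_tm)
next
  fix n and C :: "'c set" and A k W cs
  assume "jr_instance n C A k W \<and> distinct cs \<and> set cs = C"
  then show "if justified_representation n A k W
      then accepts_within jr_tm (encode_instance n cs A W) (poly time_poly (n + card C))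
      else rejects_within jr_tm (encode_instance n cs A W) (poly time_poly (n + card C))"
    using jr_tm_decides[of n C A k W cs]
    by (auto simp: accepts_within_def rejects_within_def jr_tm_def simp del: code.simps)
qed

end
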